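(* Let $n,m\ge1$, let $\mathcal{X}\subset\mathbb{R}^n$ be nonempty, compact and convex, and let $g=(g_1,\dots,g_m)^T:\mathbb{R}^n\to\mathbb{R}^m$ have convex $C^2$ components. Let $b=(b_1,\dots,b_n)$ be non-negative reals, $B=\max_{1\le i\le n}b_i$, $\epsilon>0$ and $\delta\in(0,1)$. Let $K_g$ be the Lipschitz constant of $g$ over $\mathcal{X}$ (Euclidean norms). Then the mechanism $$(M_gx)(k)=g\big(x(k)\big)+w_g(k),\qquad k\ge0,$$ where the $w_g(k)\sim\mathcal{N}(0,\sigma_g^2I_m)$ are independent over $k$ and $$\sigma_g\ge\kappa(\delta,\epsilon)\,K_g\,B,$$ is $(\epsilon,\delta)$-differentially private with respect to the adjacency relation $\mathrm{Adj}_b$ on $\mathcal{X}$-valued signals.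
   Context: The Lipschitz constant of a map is its smallest Lipschitz constant. $\mathcal{N}(0,\sigma^2I_m)$ with $\sigma=0$ is the point mass at $0$. $\mathcal{Q}(x)=\frac{1}{\sqrt{2\pi}}\int_x^\infty e^{-u^2/2}\,du$, $K_\delta=\mathcal{Q}^{-1}(\delta)$, and $\kappa(\delta,\epsilon)=\frac{1}{2\epsilon}\left(K_\delta+\sqrt{K_\delta^2+2\epsilon}\right)$. Input signals are (deterministic) sequences $x=(x(0),x(1),\dots)$ with $x(k)=(x_1(k),\dots,x_n(k))^T\in\mathcal{X}$; the $j$-th component signal is $x_j=(x_j(k))_{k\ge0}$. Adjacency: $\mathrm{Adj}_b(x,\tilde x)$ holds if and only if there is an index $l$ such that $\|x_l-\tilde x_l\|_2=\left(\sum_{k\ge0}|x_l(k)-\tilde x_l(k)|^2\right)^{1/2}\le b_l$ and $x_j=\tilde x_j$ for all $j\ne l$. A mechanism $M$ is a map sending each input signal $x$ to a random sequence $Mx$ in $\mathbb{R}^m$. Write $(Mx)_{0:k}=((Mx)(0)^T,\dots,(Mx)(k)^T)^T\in\mathbb{R}^{(k+1)m}$. $M$ is $(\epsilon,\delta)$-differentially private if for all input signals $x,\tilde x$ with $\mathrm{Adj}_b(x,\tilde x)$, $$\mathbb{P}\big((Mx)_{0:k}\in S\big)\le e^{\epsilon}\,\mathbb{P}\big((M\tilde x)_{0:k}\in S\big)+\delta\quad\text{for all }k\ge0\text{ and all Borel }S\subseteq\mathbb{R}^{(k+1)m}.$$ *)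

theory Defs
  imports "HOL-Probability.Probability"
begin

definition lipschitz_const :: "('a::metric_space) set \<Rightarrow> ('a \<Rightarrow> 'b::metric_space) \<Rightarrow> real"
  where "lipschitz_const X f = (LEAST C. C-lipschitz_on X f)"

definition C2 :: "('a::real_normed_vector \<Rightarrow> 'b::real_normed_vector) \<Rightarrow> bool"
  where "C2 f \<longleftrightarrow>
    (\<exists>(f' :: 'a \<Rightarrow> 'a \<Rightarrow>\<^sub>L 'b) (f'' :: 'a \<Rightarrow> 'a \<Rightarrow>\<^sub>L 'a \<Rightarrow>\<^sub>L 'b).
       (\<forall>x. (f has_derivative blinfun_apply (f' x)) (at x)) \<and>
       (\<forall>x. (f' has_derivative blinfun_apply (f'' x)) (at x)) \<and>
       continuous_on UNIV f'')"

definition gaussian_tail :: "real \<Rightarrow> real"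
  where "gaussian_tail x = 1 / sqrt (2 * pi) * (LBINT u:{x..}. exp (- u\<^sup>2 / 2))"

text \<open>The function \<^const>\<open>gaussian_tail\<close> is a bijection from the reals onto the open unit
  interval, so \<open>inv\<close> is its genuine inverse at every \<open>\<delta>\<close> strictly between 0 and 1.\<close>

definition kappa :: "real \<Rightarrow> real \<Rightarrow> real"
  where "kappa \<delta> \<epsilon> =
    (let K = inv gaussian_tail \<delta> in 1 / (2 * \<epsilon>) * (K + sqrt (K\<^sup>2 + 2 * \<epsilon>)))"

text \<open>The centred normal law with covariance \<open>\<sigma>\<^sup>2\<close> times the identity. Since
  \<^term>\<open>normal_density 0 0\<close> vanishes identically, the point mass needs its own case.\<close>

definition isotropic_gaussian :: "real \<Rightarrow> (real ^ 'm) measure"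
  where "isotropic_gaussian \<sigma> =
    (if \<sigma> = 0 then return borel 0
     else density lborel (\<lambda>v. ennreal (\<Prod>i\<in>UNIV. normal_density 0 \<sigma> (v $ i))))"

text \<open>Summability is required explicitly because \<^const>\<open>suminf\<close> has no meaningful value on a
  divergent series, whereas an infinite distance must not count as being within the bound.\<close>

definition Adj :: "('n::finite \<Rightarrow> real) \<Rightarrow> (nat \<Rightarrow> real ^ 'n) \<Rightarrow> (nat \<Rightarrow> real ^ 'n) \<Rightarrow> bool"
  where "Adj b x x' \<longleftrightarrow>
    (\<exists>l. summable (\<lambda>k. \<bar>x k $ l - x' k $ l\<bar>\<^sup>2) \<and>
         sqrt (\<Sum>k. \<bar>x k $ l - x' k $ l\<bar>\<^sup>2) \<le> b l \<and>
         (\<forall>j. j \<noteq> l \<longrightarrow> (\<forall>k. x k $ j = x' k $ j)))"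

text \<open>A mechanism maps a signal to a random sequence over the probability space \<open>P\<close>; only its
  values on \<open>X\<close>-valued signals matter.\<close>

definition mechanism ::
    "'w measure \<Rightarrow> 'a set \<Rightarrow> ((nat \<Rightarrow> 'a) \<Rightarrow> 'w \<Rightarrow> nat \<Rightarrow> 'b::topological_space) \<Rightarrow> bool"
  where "mechanism P X M \<longleftrightarrow>
    (\<forall>x. (\<forall>k. x k \<in> X) \<longrightarrow> (\<forall>k. (\<lambda>\<omega>. M x \<omega> k) \<in> borel_measurable P))"

text \<open>The stacked outputs at times 0 to \<open>k\<close> form an element of the \<open>(k + 1)\<close>-fold product of the
  output space. As that space is second countable, the product \<open>\<sigma>\<close>-algebra is the Borel
  \<open>\<sigma>\<close>-algebra of the product.\<close>

definition differentially_private ::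
    "'w measure \<Rightarrow> (real ^ 'n) set \<Rightarrow> ('n::finite \<Rightarrow> real) \<Rightarrow> real \<Rightarrow> real \<Rightarrow>
     ((nat \<Rightarrow> real ^ 'n) \<Rightarrow> 'w \<Rightarrow> nat \<Rightarrow> real ^ 'm) \<Rightarrow> bool"
  where "differentially_private P X b \<epsilon> \<delta> M \<longleftrightarrow>
    mechanism P X M \<and>
    (\<forall>x x'. (\<forall>k. x k \<in> X) \<longrightarrow> (\<forall>k. x' k \<in> X) \<longrightarrow> Adj b x x' \<longrightarrow>
      (\<forall>k. \<forall>S \<in> sets (\<Pi>\<^sub>M i\<in>{0..k}. (borel :: (real ^ 'm) measure)).
         \<P>(\<omega> in P. restrict (M x \<omega>) {0..k} \<in> S)
           \<le> exp \<epsilon> * \<P>(\<omega> in P. restrict (M x' \<omega>) {0..k} \<in> S) + \<delta>))"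

end

theory Submission
  imports Defs
begin

text \<open>The noise added to a stretch of outputs is a Gaussian vector with independent coordinates
  of deviation \<open>\<sigma>\<close>, so only the Euclidean distance \<open>d\<close> between the two stacked noiseless outputs
  matters. Adjacent signals differ in one component by at most \<open>b l\<close> in the \<open>\<ell>\<^sup>2\<close> norm, and applying \<open>g\<close> at
  each time multiplies distances by at most its Lipschitz constant on \<open>X\<close>; summing squares over time,
  \<open>d\<close> is at most the Lipschitz constant times the largest \<open>b i\<close> (\<open>Adj_sum_norm_le\<close>, and
  \<open>lipschitz_const_lipschitz\<close> for the fact that the least constant exists and works). Hence
  \<open>kappa \<delta> \<epsilon> * d \<le> \<sigma>\<close>.

  For two laws with densities \<open>p\<close> and \<open>q\<close>, the privacy inequality holds as soon as the first law
  gives probability at most \<open>\<delta>\<close> to the set where \<open>p > exp \<epsilon> * q\<close> (\<open>prob_le_of_privacy_loss\<close>). For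
  Gaussian densities with centres at distance \<open>d\<close>, this set is the event that the inner product
  of the noise with the difference of the centres exceeds \<open>\<epsilon> * \<sigma>\<^sup>2 - d\<^sup>2 / 2\<close>
  (\<open>gaussian_privacy_loss_iff\<close>). That inner product is a normal variable of deviation \<open>\<sigma> * d\<close>, so
  the probability is the Gaussian tail at \<open>\<epsilon> * r - 1 / (2 * r)\<close> with \<open>r = \<sigma> / d\<close>. The constant \<open>kappa \<delta> \<epsilon>\<close>
  is the positive \<open>r\<close> at which this tail is \<open>\<delta>\<close>, and the point only moves up with
  \<open>r\<close> (\<open>inv_gaussian_tail_le_privacy_threshold\<close>), so the tail is at most \<open>\<delta>\<close>.

  When \<open>d = 0\<close> the two outputs coincide and there is nothing to compare; since \<open>kappa\<close> is
  positive, noise of deviation 0 occurs only in this case.\<close>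

section \<open>Linear functionals of isotropic Gaussian noise\<close>

text \<open>The product formula for Lebesgue measure on a Euclidean space speaks of the basis vectors;
  here it is transported to coordinates along the bijection from indices to axis vectors.\<close>

lemma nn_integral_lborel_cart_prod:
  fixes f :: "'m::finite \<Rightarrow> real \<Rightarrow> ennreal"
  assumes [measurable]: "\<And>i. f i \<in> borel_measurable borel"
  shows "(\<integral>\<^sup>+v. (\<Prod>i\<in>UNIV. f i ((v :: real ^ 'm) $ i)) \<partial>lborel) = (\<Prod>i\<in>UNIV. \<integral>\<^sup>+t. f i t \<partial>lborel)"
proof -
  \<comment> \<open>the inverse of the bijection that sends an index to its axis vector\<close>
  define idx where "idx b = (THE i :: 'm. b = axis i (1 :: real))" for b
  have idx [simp]: "idx (axis i 1) = i" for i
    unfolding idx_def by (rule the_equality) (auto simp: axis_eq_axis)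
  have Basis: "(Basis :: (real ^ 'm) set) = (\<lambda>i. axis i 1) ` UNIV"
    by (auto simp: Basis_vec_def)
  have inj: "inj (\<lambda>i :: 'm. axis i (1 :: real))"
    by (auto simp: inj_def axis_eq_axis)
  have "(\<integral>\<^sup>+v. (\<Prod>b\<in>Basis. f (idx b) ((v :: real ^ 'm) \<bullet> b)) \<partial>lborel) =
      (\<Prod>b\<in>(Basis :: (real ^ 'm) set). \<integral>\<^sup>+t. f (idx b) t \<partial>lborel)"
    by (rule nn_integral_lborel_prod) auto
  then show ?thesis
    unfolding Basis by (simp add: prod.reindex[OF inj] cart_eq_inner_axis[symmetric])
qed

text \<open>The density of the isotropic law is a product of one-dimensional densities, so the law of
  a box factorises. Boxes with a single constrained side give the marginals, and the general
  box then gives independence.\<close>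

lemma (in prob_space) isotropic_gaussian_components:
  fixes W :: "'a \<Rightarrow> real ^ 'm"
  assumes W [measurable]: "random_variable borel W"
    and law: "distr M borel W = isotropic_gaussian \<sigma>" and "0 < \<sigma>"
  shows "distributed M lborel (\<lambda>\<omega>. W \<omega> $ i) (normal_density 0 \<sigma>)"
    and "indep_vars (\<lambda>_. borel) (\<lambda>i \<omega>. W \<omega> $ i) UNIV"
proof -
  define N where "N = density lborel (normal_density 0 \<sigma>)"
  interpret N: prob_space N
    unfolding N_def by (rule prob_space_normal_density) fact
  have [simp, measurable_cong]: "sets N = sets borel" and [simp]: "space N = UNIV"
    by (auto simp: N_def)
  have [measurable]: "(\<lambda>v :: real ^ 'm. v $ i) \<in> borel_measurable borel" for i
    by (intro borel_measurable_continuous_onI continuous_intros)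
  have box: "emeasure M {\<omega> \<in> space M. \<forall>i. W \<omega> $ i \<in> A i} = (\<Prod>i\<in>UNIV. emeasure N (A i))"
    if [measurable]: "\<And>i. A i \<in> sets borel" for A
  proof -
    let ?B = "{v :: real ^ 'm. \<forall>i. v $ i \<in> A i}"
    have B [measurable]: "?B \<in> sets borel"
      by measurable
    have "{\<omega> \<in> space M. \<forall>i. W \<omega> $ i \<in> A i} = W -` ?B \<inter> space M"
      by auto
    then have "emeasure M {\<omega> \<in> space M. \<forall>i. W \<omega> $ i \<in> A i} = emeasure (distr M borel W) ?B"
      by (simp add: emeasure_distr)
    also have "\<dots> = (\<integral>\<^sup>+v. ennreal (\<Prod>i\<in>UNIV. normal_density 0 \<sigma> (v $ i)) * indicator ?B v \<partial>lborel)"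
      using \<open>0 < \<sigma>\<close> by (simp add: law isotropic_gaussian_def emeasure_density)
    also have "\<dots> = (\<integral>\<^sup>+v. (\<Prod>i\<in>UNIV. ennreal (normal_density 0 \<sigma> (v $ i)) * indicator (A i) (v $ i)) \<partial>lborel)"
    proof (intro nn_integral_cong)
      fix v :: "real ^ 'm"
      have "indicator ?B v = (\<Prod>i\<in>UNIV. indicator (A i) (v $ i) :: ennreal)"
        by (cases "v \<in> ?B") (auto simp: indicator_def intro!: prod_zero[symmetric])
      then show "ennreal (\<Prod>i\<in>UNIV. normal_density 0 \<sigma> (v $ i)) * indicator ?B v =
          (\<Prod>i\<in>UNIV. ennreal (normal_density 0 \<sigma> (v $ i)) * indicator (A i) (v $ i))"
        by (simp add: prod.distrib prod_ennreal)
    qed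
    also have "\<dots> = (\<Prod>i\<in>UNIV. \<integral>\<^sup>+t. ennreal (normal_density 0 \<sigma> t) * indicator (A i) t \<partial>lborel)"
      by (rule nn_integral_lborel_cart_prod) measurable
    also have "\<dots> = (\<Prod>i\<in>UNIV. emeasure N (A i))"
      by (simp add: N_def emeasure_density)
    finally show ?thesis .
  qed
  have distr: "distr M borel (\<lambda>\<omega>. W \<omega> $ i) = N" for i
  proof (rule measure_eqI)
    fix S assume "S \<in> sets (distr M borel (\<lambda>\<omega>. W \<omega> $ i))"
    then have [measurable]: "S \<in> sets borel"
      by simp
    have "(\<lambda>\<omega>. W \<omega> $ i) -` S \<inter> space M = {\<omega> \<in> space M. \<forall>j. W \<omega> $ j \<in> (if j = i then S else UNIV)}"
      by (auto split: if_splits)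
    then have "emeasure (distr M borel (\<lambda>\<omega>. W \<omega> $ i)) S = (\<Prod>j\<in>UNIV. emeasure N (if j = i then S else UNIV))"
      by (simp add: emeasure_distr box)
    also have "\<dots> = (\<Prod>j\<in>UNIV. if j = i then emeasure N S else 1)"
      using N.emeasure_space_1 by (intro prod.cong) auto
    finally show "emeasure (distr M borel (\<lambda>\<omega>. W \<omega> $ i)) S = emeasure N S"
      by (simp add: prod.delta)
  qed simp
  have "distr M lborel (\<lambda>\<omega>. W \<omega> $ i) = N" 
    using distr[of i] by (simp cong: distr_cong)
  then show "distributed M lborel (\<lambda>\<omega>. W \<omega> $ i) (normal_density 0 \<sigma>)"
    unfolding distributed_def N_def by auto
  interpret product_sigma_finite "\<lambda>_ :: 'm. N"
    by standard
  have "distr M (\<Pi>\<^sub>M i\<in>UNIV. borel) (\<lambda>\<omega>. \<lambda>i\<in>UNIV. W \<omega> $ i) = (\<Pi>\<^sub>M i\<in>UNIV. N)"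
  proof (rule PiM_eqI)
    fix A :: "'m \<Rightarrow> real set" assume A: "\<And>i. i \<in> UNIV \<Longrightarrow> A i \<in> sets N"
    have "(\<lambda>\<omega>. \<lambda>i\<in>UNIV. W \<omega> $ i) -` Pi\<^sub>E UNIV A \<inter> space M = {\<omega> \<in> space M. \<forall>i. W \<omega> $ i \<in> A i}"
      by auto
    with A show "emeasure (distr M (\<Pi>\<^sub>M i\<in>UNIV. borel) (\<lambda>\<omega>. \<lambda>i\<in>UNIV. W \<omega> $ i)) (Pi\<^sub>E UNIV A) =
        (\<Prod>i\<in>UNIV. emeasure N (A i))"
      by (simp add: emeasure_distr box sets_PiM_I_finite)
  qed (auto intro!: sets_PiM_cong)
  then show "indep_vars (\<lambda>_. borel) (\<lambda>i \<omega>. W \<omega> $ i) UNIV"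
    by (subst indep_vars_iff_distr_eq_PiM) (auto simp: distr)
qed

text \<open>A deviation \<open>s i = 0\<close> stands for a variable that vanishes, because \<open>normal_density 0 0\<close>
  is not the density of the point mass. Allowing it here spares the later arguments from
  treating coordinates and times at which the two outputs agree separately.\<close>

lemma (in prob_space) sum_indep_centred_normal:
  assumes "finite I" and indep: "indep_vars (\<lambda>_. borel) X I"
    and normal: "\<And>i. i \<in> I \<Longrightarrow> 0 < s i \<Longrightarrow> distributed M lborel (X i) (normal_density 0 (s i))"
    and zero: "\<And>i \<omega>. i \<in> I \<Longrightarrow> s i = 0 \<Longrightarrow> X i \<omega> = 0"
    and nonneg: "\<And>i. i \<in> I \<Longrightarrow> 0 \<le> s i"
    and pos: "0 < (\<Sum>i\<in>I. (s i)\<^sup>2)"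
  shows "distributed M lborel (\<lambda>\<omega>. \<Sum>i\<in>I. X i \<omega>) (normal_density 0 (sqrt (\<Sum>i\<in>I. (s i)\<^sup>2)))"
proof -
  define J where "J = {i \<in> I. s i \<noteq> 0}"
  have J: "J \<subseteq> I" "finite J" "\<And>i. i \<in> I - J \<Longrightarrow> s i = 0"
    using \<open>finite I\<close> by (auto simp: J_def)
  have sq: "(\<Sum>i\<in>I. (s i)\<^sup>2) = (\<Sum>i\<in>J. (s i)\<^sup>2)"
    using J \<open>finite I\<close> by (intro sum.mono_neutral_right) auto
  have "J \<noteq> {}"
    using pos unfolding sq by auto
  have "s i > 0" if "i \<in> J" for i
    using that nonneg[of i] by (auto simp: J_def)
  then have "distributed M lborel (\<lambda>\<omega>. \<Sum>i\<in>J. X i \<omega>) (normal_density (\<Sum>i\<in>J. 0) (sqrt (\<Sum>i\<in>J. (s i)\<^sup>2)))"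
    using J \<open>J \<noteq> {}\<close> indep_vars_subset[OF indep]
    by (intro sum_indep_normal) (auto intro!: normal)
  moreover have "(\<Sum>i\<in>I. X i \<omega>) = (\<Sum>i\<in>J. X i \<omega>)" for \<omega>
    using J \<open>finite I\<close> zero by (intro sum.mono_neutral_right) auto
  ultimately show ?thesis
    unfolding sq by simp
qed

text \<open>The inner product is a linear combination of the independent coordinates of the noise;
  the variances of its terms add up to \<open>\<sigma>\<^sup>2\<close> times the squared norm of \<open>v\<close>.\<close>

lemma (in prob_space) inner_isotropic_gaussian:
  fixes W :: "'a \<Rightarrow> real ^ 'm"
  assumes W: "random_variable borel W"
    and law: "distr M borel W = isotropic_gaussian \<sigma>" and "0 < \<sigma>" and "v \<noteq> 0"
  shows "distributed M lborel (\<lambda>\<omega>. W \<omega> \<bullet> v) (normal_density 0 (\<sigma> * norm v))"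
proof -
  note comp = isotropic_gaussian_components[OF W law \<open>0 < \<sigma>\<close>]
  let ?s = "\<lambda>i. \<bar>v $ i\<bar> * \<sigma>"
  have "(\<Sum>i\<in>UNIV. (?s i)\<^sup>2) = (\<sigma> * norm v)\<^sup>2"
    by (simp add: norm_vec_def L2_set_def power_mult_distrib sum_nonneg sum_distrib_left mult.commute)
  moreover have "0 < (\<sigma> * norm v)\<^sup>2"
    using assms by simp
  moreover have "distributed M lborel (\<lambda>\<omega>. \<Sum>i\<in>UNIV. v $ i * W \<omega> $ i)
      (normal_density 0 (sqrt (\<Sum>i\<in>UNIV. (?s i)\<^sup>2)))"
  proof (rule sum_indep_centred_normal)
    show "indep_vars (\<lambda>_. borel) (\<lambda>i \<omega>. v $ i * W \<omega> $ i) UNIV"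
      by (rule indep_vars_compose2[OF comp(2)]) auto
    show "distributed M lborel (\<lambda>\<omega>. v $ i * W \<omega> $ i) (normal_density 0 (?s i))" if "0 < ?s i" for i
      using normal_density_affine[OF comp(1)[of i] \<open>0 < \<sigma>\<close>, of "v $ i" 0] that \<open>0 < \<sigma>\<close>
      by (auto simp: zero_less_mult_iff)
  qed (use \<open>0 < \<sigma>\<close> calculation in auto)
  ultimately show ?thesis
    using \<open>0 < \<sigma>\<close> by (simp add: inner_vec_def mult.commute)
qed

section \<open>Joint densities and the privacy loss\<close>

text \<open>Independence makes the joint law the product of the marginal laws, and a product of laws
  with densities has the product density, since both measures agree on boxes.\<close>

lemma (in prob_space) joint_distributed_PiM:
  assumes "finite I" and "I \<noteq> {}" and "sigma_finite_measure N"
    and indep: "indep_vars (\<lambda>_. N) Y I"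
    and dist: "\<And>i. distributed M N (Y i) (f i)"
  shows "distributed M (\<Pi>\<^sub>M i\<in>I. N) (\<lambda>\<omega>. \<lambda>i\<in>I. Y i \<omega>) (\<lambda>y. \<Prod>i\<in>I. f i (y i))"
proof -
  have rv [measurable]: "Y i \<in> measurable M N" and f [measurable]: "f i \<in> borel_measurable N"
    and law: "distr M N (Y i) = density N (f i)" for i
    using dist[of i] by (auto simp: distributed_def)
  interpret N: product_sigma_finite "\<lambda>_. N"
    using \<open>sigma_finite_measure N\<close> by (simp add: product_sigma_finite_def)
  interpret D: product_prob_space "\<lambda>i. distr M N (Y i)" I
    unfolding product_prob_space_def product_prob_space_axioms_def product_sigma_finite_def
    by (auto intro!: prob_space_distr prob_space_imp_sigma_finite)
  have "distr M (\<Pi>\<^sub>M i\<in>I. N) (\<lambda>\<omega>. \<lambda>i\<in>I. Y i \<omega>) = (\<Pi>\<^sub>M i\<in>I. distr M N (Y i))"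
    using indep by (subst (asm) indep_vars_iff_distr_eq_PiM[OF \<open>I \<noteq> {}\<close> rv]) simp
  also have "\<dots> = density (\<Pi>\<^sub>M i\<in>I. N) (\<lambda>y. \<Prod>i\<in>I. f i (y i))"
  proof (rule D.PiM_eqI[symmetric])
    fix A assume "\<And>i. i \<in> I \<Longrightarrow> A i \<in> sets (distr M N (Y i))"
    then have A [measurable]: "i \<in> I \<Longrightarrow> A i \<in> sets N" for i
      by simp
    have "emeasure (density (\<Pi>\<^sub>M i\<in>I. N) (\<lambda>y. \<Prod>i\<in>I. f i (y i))) (Pi\<^sub>E I A) =
        (\<integral>\<^sup>+y. (\<Prod>i\<in>I. f i (y i)) * indicator (Pi\<^sub>E I A) y \<partial>(\<Pi>\<^sub>M i\<in>I. N))"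
      using \<open>finite I\<close> by (intro emeasure_density sets_PiM_I_finite) auto
    also have "\<dots> = (\<integral>\<^sup>+y. (\<Prod>i\<in>I. f i (y i) * indicator (A i) (y i)) \<partial>(\<Pi>\<^sub>M i\<in>I. N))"
    proof (intro nn_integral_cong)
      fix y assume "y \<in> space (\<Pi>\<^sub>M i\<in>I. N)"
      then have "indicator (Pi\<^sub>E I A) y = (\<Prod>i\<in>I. indicator (A i) (y i) :: ennreal)"
        using \<open>finite I\<close>
        by (cases "y \<in> Pi\<^sub>E I A") (auto simp: indicator_def space_PiM PiE_def intro!: prod_zero[symmetric] prod.neutral)
      then show "(\<Prod>i\<in>I. f i (y i)) * indicator (Pi\<^sub>E I A) y = (\<Prod>i\<in>I. f i (y i) * indicator (A i) (y i))"
        by (simp add: prod.distrib)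
    qed
    also have "\<dots> = (\<Prod>i\<in>I. \<integral>\<^sup>+t. f i t * indicator (A i) t \<partial>N)"
      using \<open>finite I\<close> by (intro N.product_nn_integral_prod) auto
    also have "\<dots> = (\<Prod>i\<in>I. emeasure (distr M N (Y i)) (A i))"
      by (intro prod.cong) (auto simp: law emeasure_density)
    finally show "emeasure (density (\<Pi>\<^sub>M i\<in>I. N) (\<lambda>y. \<Prod>i\<in>I. f i (y i))) (Pi\<^sub>E I A) =
        (\<Prod>i\<in>I. emeasure (distr M N (Y i)) (A i))" .
  qed (auto intro: \<open>finite I\<close> cong: sets_PiM_cong)
  finally show ?thesis
    unfolding distributed_def by auto
qed

text \<open>Split \<open>S\<close> according to whether \<open>p\<close> exceeds \<open>c * q\<close>. Where it does not, \<open>p\<close> is replaced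
  by \<open>c * q\<close>; the remaining part contributes at most the probability that the likelihood
  ratio \<open>p / q\<close>, evaluated at the actual output, exceeds \<open>c\<close>.\<close>

lemma (in prob_space) prob_le_of_privacy_loss:
  fixes p q :: "'b \<Rightarrow> ennreal"
  assumes Y: "distributed M N Y p" and Y': "distributed M N Y' q" and S: "S \<in> sets N"
  shows "emeasure M (Y -` S \<inter> space M) \<le>
    c * emeasure M (Y' -` S \<inter> space M) + emeasure M {\<omega> \<in> space M. c * q (Y \<omega>) < p (Y \<omega>)}"
proof -
  have [measurable]: "p \<in> borel_measurable N" "q \<in> borel_measurable N" "Y \<in> measurable M N" "S \<in> sets N"
    using assms by (auto simp: distributed_def)
  let ?L = "{y \<in> space N. c * q y < p y}"
  have "emeasure M (Y -` S \<inter> space M) = (\<integral>\<^sup>+y. p y * indicator S y \<partial>N)"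
    by (rule distributed_emeasure[OF Y S])
  also have "\<dots> \<le> (\<integral>\<^sup>+y. c * (q y * indicator S y) + p y * indicator ?L y \<partial>N)"
    by (intro nn_integral_mono) (auto simp: indicator_def not_less)
  also have "\<dots> = c * (\<integral>\<^sup>+y. q y * indicator S y \<partial>N) + (\<integral>\<^sup>+y. p y * indicator ?L y \<partial>N)"
    by (simp add: nn_integral_add nn_integral_cmult)
  also have "\<dots> = c * emeasure M (Y' -` S \<inter> space M) + emeasure M (Y -` ?L \<inter> space M)"
    using distributed_emeasure[OF Y, of ?L] distributed_emeasure[OF Y' S] by simp
  also have "Y -` ?L \<inter> space M = {\<omega> \<in> space M. c * q (Y \<omega>) < p (Y \<omega>)}"
    using measurable_space[OF \<open>Y \<in> measurable M N\<close>] by auto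
  finally show ?thesis .
qed

section \<open>The Gaussian tail and the constant kappa\<close>

interpretation std_normal: real_distribution std_normal_distribution
  by (rule real_dist_normal_dist)

lemma gaussian_tail_eq: "gaussian_tail x = measure std_normal_distribution {x..}"
proof -
  have "measure std_normal_distribution {x..} = (LINT u|std_normal_distribution. indicator {x..} u)"
    by simp
  also have "\<dots> = (LBINT u. std_normal_density u * indicator {x..} u)"
    by (rule integral_real_density) auto
  also have "\<dots> = (LBINT u:{x..}. 1 / sqrt (2 * pi) * exp (- u\<^sup>2 / 2))"
    unfolding set_lebesgue_integral_def std_normal_density_def
    by (intro Bochner_Integration.integral_cong) auto
  also have "\<dots> = gaussian_tail x"
    unfolding gaussian_tail_def by (rule set_integral_mult_right)
  finally show ?thesis
    by (rule sym)
qed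

lemma measure_std_normal_singleton: "measure std_normal_distribution {x} = 0"
proof -
  have "emeasure std_normal_distribution {x} = 0"
    by (subst emeasure_density) (auto simp: nn_integral_0_iff_AE intro!: AE_I[of _ _ "{x}"] split: split_indicator)
  then show ?thesis
    by (simp add: measure_def)
qed

lemma gaussian_tail_eq_cdf: "gaussian_tail x = 1 - cdf std_normal_distribution x"
proof -
  have "measure std_normal_distribution {x..} = measure std_normal_distribution ({x} \<union> {x<..})"
    by (rule arg_cong[where f = "measure std_normal_distribution"]) auto
  also have "\<dots> = measure std_normal_distribution {x<..}"
    by (subst std_normal.finite_measure_Union) (auto simp: measure_std_normal_singleton)
  also have "{x<..} = space std_normal_distribution - {..x}"
    by auto
  also have "measure std_normal_distribution \<dots> = 1 - cdf std_normal_distribution x"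
    unfolding cdf_def by (rule std_normal.prob_compl) simp
  finally show ?thesis
    by (simp add: gaussian_tail_eq)
qed

lemma gaussian_tail_antimono: "x \<le> y \<Longrightarrow> gaussian_tail y \<le> gaussian_tail x"
  by (simp add: gaussian_tail_eq_cdf std_normal.cdf_nondecreasing)

text \<open>Expressed through the distribution function, the tail is continuous because the normal law
  has no atoms, and it tends to 1 and 0 at the two ends, so it attains every value in between.
  Hence \<open>inv\<close> is a genuine right inverse at such values.\<close>

lemma gaussian_tail_inv:
  assumes "0 < \<delta>" and "\<delta> < 1"
  shows "gaussian_tail (inv gaussian_tail \<delta>) = \<delta>"
proof -
  have "eventually (\<lambda>x. cdf std_normal_distribution x < 1 - \<delta>) at_bot"
    using std_normal.cdf_lim_at_bot assms by (intro order_tendstoD(2)) auto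
  then obtain a where a: "cdf std_normal_distribution a < 1 - \<delta>"
    by (auto simp: eventually_at_bot_linorder)
  have "eventually (\<lambda>x. 1 - \<delta> < cdf std_normal_distribution x) at_top"
    using std_normal.cdf_lim_at_top_prob assms by (intro order_tendstoD(1)) auto
  then obtain c where c: "1 - \<delta> < cdf std_normal_distribution c"
    by (auto simp: eventually_at_top_linorder)
  have "a \<le> c"
    using std_normal.cdf_nondecreasing[of c a] a c by linarith
  then obtain x where "cdf std_normal_distribution x = 1 - \<delta>"
    using a c IVT[of "cdf std_normal_distribution" a "1 - \<delta>" c]
    by (auto simp: std_normal.isCont_cdf measure_std_normal_singleton)
  then have "gaussian_tail x = \<delta>"
    by (simp add: gaussian_tail_eq_cdf)
  then show ?thesis
    by (intro f_inv_into_f) (rule range_eqI[OF sym])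
qed

lemma (in prob_space) prob_normal_gt_le_gaussian_tail:
  assumes T: "distributed M lborel T (normal_density 0 s)" and "0 < s"
  shows "prob {\<omega> \<in> space M. t < T \<omega>} \<le> gaussian_tail (t / s)"
proof -
  have std: "distributed M lborel (\<lambda>\<omega>. T \<omega> / s) std_normal_density"
    using T normal_standard_normal_convert[OF \<open>0 < s\<close>, of T 0] by simp
  then have [measurable]: "(\<lambda>\<omega>. T \<omega> / s) \<in> borel_measurable M"
    by (simp add: distributed_def)
  have "prob {\<omega> \<in> space M. t < T \<omega>} \<le> prob ((\<lambda>\<omega>. T \<omega> / s) -` {t / s..} \<inter> space M)"
    using \<open>0 < s\<close> by (intro finite_measure_mono) (auto simp: divide_right_mono)
  also have "\<dots> = measure (distr M lborel (\<lambda>\<omega>. T \<omega> / s)) {t / s..}"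
    by (simp add: measure_distr)
  also have "\<dots> = gaussian_tail (t / s)"
    using std by (simp add: distributed_def gaussian_tail_eq)
  finally show ?thesis .
qed

lemma kappa_pos: "0 < \<epsilon> \<Longrightarrow> 0 < kappa \<delta> \<epsilon>"
proof -
  assume "0 < \<epsilon>"
  let ?K = "inv gaussian_tail \<delta>"
  have "- ?K \<le> sqrt (?K\<^sup>2)"
    by simp
  also have "\<dots> < sqrt (?K\<^sup>2 + 2 * \<epsilon>)"
    using \<open>0 < \<epsilon>\<close> by (intro real_sqrt_less_mono) simp
  finally show ?thesis
    using \<open>0 < \<epsilon>\<close> by (simp add: kappa_def Let_def)
qed

text \<open>Up to normalisation, this is the quadratic equation of which \<open>kappa \<delta> \<epsilon>\<close> is the positive
  root. When the deviation of the noise is \<open>r\<close> times the distance of the outputs, the privacy loss exceeds \<open>\<epsilon>\<close> if a standard normal variable exceeds \<open>\<epsilon> * r - 1 / (2 * r)\<close>;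
  the equation says that for \<open>r = kappa \<delta> \<epsilon>\<close> this point is \<open>inv gaussian_tail \<delta>\<close>.\<close>

lemma kappa_quadratic:
  assumes "0 < \<epsilon>"
  shows "\<epsilon> * (kappa \<delta> \<epsilon>)\<^sup>2 = inv gaussian_tail \<delta> * kappa \<delta> \<epsilon> + 1 / 2"
proof -
  define K where "K = inv gaussian_tail \<delta>"
  define R where "R = sqrt (K\<^sup>2 + 2 * \<epsilon>)"
  have R: "R * R = K * K + 2 * \<epsilon>"
    using assms by (simp add: R_def power2_eq_square)
  have kap: "kappa \<delta> \<epsilon> = (K + R) / (2 * \<epsilon>)"
    by (simp add: kappa_def Let_def K_def R_def)
  have "(K + R) * (K + R) = 2 * K * (K + R) + 2 * \<epsilon>"
    using R by (simp add: algebra_simps)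
  then show ?thesis
    using assms unfolding kap K_def[symmetric] by (simp add: power2_eq_square field_simps)
qed

text \<open>With \<open>r = \<sigma> / d\<close> the right-hand side is \<open>\<epsilon> * r - 1 / (2 * r)\<close>. It increases with \<open>r\<close>, and it
  equals the left-hand side at \<open>r = kappa \<delta> \<epsilon>\<close>.\<close>

lemma inv_gaussian_tail_le_privacy_threshold:
  assumes "0 < \<epsilon>" and "0 < d" and "kappa \<delta> \<epsilon> * d \<le> \<sigma>"
  shows "inv gaussian_tail \<delta> \<le> (\<epsilon> * \<sigma>\<^sup>2 - d\<^sup>2 / 2) / (\<sigma> * d)"
proof -
  define K where "K = inv gaussian_tail \<delta>"
  define k where "k = kappa \<delta> \<epsilon>"
  define r where "r = \<sigma> / d"
  have k: "0 < k"
    using kappa_pos[OF assms(1)] by (simp add: k_def)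
  have "\<epsilon> * k\<^sup>2 = K * k + 1 / 2"
    using kappa_quadratic[OF assms(1)] by (simp add: k_def K_def)
  then have quad: "K = \<epsilon> * k - 1 / (2 * k)"
    using k by (simp add: power2_eq_square field_simps)
  have "k \<le> r"
    using assms by (simp add: r_def k_def field_simps)
  have "0 < k * d"
    using k assms(2) by simp
  then have "0 < \<sigma>"
    using assms(3) by (simp add: k_def)
  have "\<epsilon> * k - 1 / (2 * k) \<le> \<epsilon> * r - 1 / (2 * r)"
    using k assms(1) \<open>k \<le> r\<close> by (intro diff_mono mult_left_mono divide_left_mono) auto
  also have "\<dots> = (\<epsilon> * \<sigma>\<^sup>2 - d\<^sup>2 / 2) / (\<sigma> * d)"
    using assms(2) \<open>0 < \<sigma>\<close> by (simp add: r_def diff_divide_distrib power2_eq_square)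
  finally show ?thesis
    unfolding quad K_def[symmetric] .
qed

section \<open>Lipschitz constants and adjacent signals\<close>

text \<open>The Lipschitz condition consists of non-strict inequalities in the constant, so the
  infimum of all Lipschitz constants is itself one, and \<open>LEAST\<close> denotes an attained minimum.\<close>

lemma lipschitz_const_lipschitz:
  assumes "C-lipschitz_on X f"
  shows "(lipschitz_const X f)-lipschitz_on X f"
proof -
  define I where "I = {C. C-lipschitz_on X f}"
  have "C \<in> I"
    using assms by (simp add: I_def)
  have bdd: "bdd_below I"
    by (rule bdd_belowI[of _ 0]) (auto simp: I_def dest: lipschitz_on_nonneg)
  have "(Inf I)-lipschitz_on X f"
  proof (rule lipschitz_onI)
    show "0 \<le> Inf I"
      using \<open>C \<in> I\<close> by (intro cInf_greatest) (auto simp: I_def dest: lipschitz_on_nonneg)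
    show "dist (f x) (f y) \<le> Inf I * dist x y" if "x \<in> X" "y \<in> X" for x y
    proof (cases "x = y")
      case False
      have "dist (f x) (f y) / dist x y \<le> Inf I"
        using \<open>C \<in> I\<close> False that
        by (intro cInf_greatest) (auto simp: I_def field_simps dest: lipschitz_onD)
      then show ?thesis
        using False by (simp add: field_simps)
    qed simp
  qed
  moreover from this have "lipschitz_const X f = Inf I"
    unfolding lipschitz_const_def using bdd
    by (intro Least_equality) (auto simp: I_def intro: cInf_lower)
  ultimately show ?thesis
    by simp
qed

text \<open>The continuous derivative is bounded on the compact set, and on a convex set a bound on
  the derivative is a Lipschitz constant by the mean value inequality.\<close>

lemma C2_lipschitz_on_compact_convex:
  assumes "C2 f" and "compact X" and "convex X"
  shows "\<exists>C. C-lipschitz_on X f"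
proof -
  from \<open>C2 f\<close> obtain f' f'' where
    f': "\<And>x. (f has_derivative blinfun_apply (f' x)) (at x)" and
    f'': "\<And>x. (f' has_derivative blinfun_apply (f'' x)) (at x)"
    unfolding C2_def by blast
  have "continuous_on X f'"
    by (intro continuous_at_imp_continuous_on ballI has_derivative_continuous[OF f''])
  then have "bounded (f' ` X)"
    using \<open>compact X\<close> by (intro compact_imp_bounded compact_continuous_image)
  then obtain C where C: "0 < C" "\<And>x. x \<in> X \<Longrightarrow> norm (f' x) \<le> C"
    by (auto simp: bounded_pos)
  have "norm (f x - f y) \<le> C * norm (x - y)" if "x \<in> X" "y \<in> X" for x y
    using \<open>convex X\<close> that C(2)
    by (intro differentiable_bound[of X f "\<lambda>x. blinfun_apply (f' x)"])
       (auto intro: has_derivative_at_withinI f' simp: norm_blinfun.rep_eq[symmetric])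
  then show ?thesis
    using C(1) by (intro exI[of _ C] lipschitz_onI) (auto simp: dist_norm)
qed

lemma lipschitz_on_vec_components:
  fixes f :: "'a::metric_space \<Rightarrow> real ^ 'm"
  assumes "\<And>i. \<exists>C. C-lipschitz_on X (\<lambda>x. f x $ i)"
  shows "\<exists>C. C-lipschitz_on X f"
proof -
  obtain C where C: "\<And>i. (C i)-lipschitz_on X (\<lambda>x. f x $ i)"
    using assms by metis
  have "(\<Sum>i\<in>UNIV. C i)-lipschitz_on X f"
  proof (rule lipschitz_onI)
    fix x y assume xy: "x \<in> X" "y \<in> X"
    have "dist (f x) (f y) \<le> (\<Sum>i\<in>UNIV. \<bar>(f x - f y) $ i\<bar>)"
      unfolding dist_norm by (rule norm_le_l1_cart)
    also have "\<dots> \<le> (\<Sum>i\<in>UNIV. C i * dist x y)"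
      using lipschitz_onD[OF C xy] by (intro sum_mono) (simp add: dist_real_def)
    finally show "dist (f x) (f y) \<le> (\<Sum>i\<in>UNIV. C i) * dist x y"
      by (simp add: sum_distrib_right)
  qed (use C in \<open>auto intro!: sum_nonneg dest: lipschitz_on_nonneg\<close>)
  then show ?thesis ..
qed

text \<open>Adjacent signals differ in a single component \<open>l\<close>, so the squared norms of their
  differences form the series that the adjacency relation bounds by \<open>b l\<close>; a partial sum is
  no larger, as the terms are non-negative.\<close>

lemma Adj_sum_norm_le:
  fixes x x' :: "nat \<Rightarrow> real ^ 'n" and b :: "'n \<Rightarrow> real"
  assumes "Adj b x x'" and "finite I"
  shows "sqrt (\<Sum>k\<in>I. (norm (x k - x' k))\<^sup>2) \<le> Max (range b)"
proof -
  obtain l where sm: "summable (\<lambda>k. \<bar>x k $ l - x' k $ l\<bar>\<^sup>2)"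
    and le: "sqrt (\<Sum>k. \<bar>x k $ l - x' k $ l\<bar>\<^sup>2) \<le> b l"
    and eq: "\<And>j k. j \<noteq> l \<Longrightarrow> x k $ j = x' k $ j"
    using assms(1) unfolding Adj_def by blast
  have "(norm (x k - x' k))\<^sup>2 = \<bar>x k $ l - x' k $ l\<bar>\<^sup>2" for k
  proof -
    have "(norm (x k - x' k))\<^sup>2 = (\<Sum>j\<in>UNIV. (x k $ j - x' k $ j)\<^sup>2)"
      by (simp add: norm_vec_def L2_set_def sum_nonneg)
    also have "\<dots> = (\<Sum>j\<in>{l}. (x k $ j - x' k $ j)\<^sup>2)"
      using eq by (intro sum.mono_neutral_right) auto
    finally show ?thesis
      by simp
  qed
  then have "sqrt (\<Sum>k\<in>I. (norm (x k - x' k))\<^sup>2) \<le> sqrt (\<Sum>k. \<bar>x k $ l - x' k $ l\<bar>\<^sup>2)"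
    using sm \<open>finite I\<close> by (auto intro!: sum_le_suminf)
  also have "\<dots> \<le> b l"
    by (rule le)
  also have "\<dots> \<le> Max (range b)"
    by (rule Max_ge) auto
  finally show ?thesis .
qed

section \<open>The Gaussian mechanism\<close>

lemma prod_normal_density_eq_exp_norm:
  fixes u :: "real ^ 'm"
  assumes "0 < \<sigma>"
  shows "(\<Prod>j\<in>UNIV. normal_density 0 \<sigma> (u $ j)) =
    (1 / sqrt (2 * pi * \<sigma>\<^sup>2)) ^ CARD('m) * exp (- (norm u)\<^sup>2 / (2 * \<sigma>\<^sup>2))"
proof -
  have "(\<Prod>j\<in>UNIV. normal_density 0 \<sigma> (u $ j)) =
      (1 / sqrt (2 * pi * \<sigma>\<^sup>2)) ^ CARD('m) * exp (\<Sum>j\<in>UNIV. - (u $ j)\<^sup>2 / (2 * \<sigma>\<^sup>2))"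
    by (simp add: normal_density_def prod.distrib exp_sum power_divide prod_dividef)
  also have "(\<Sum>j\<in>UNIV. - (u $ j)\<^sup>2 / (2 * \<sigma>\<^sup>2)) = - (norm u)\<^sup>2 / (2 * \<sigma>\<^sup>2)"
    by (simp add: norm_vec_def L2_set_def sum_nonneg sum_negf sum_divide_distrib)
  finally show ?thesis .
qed

text \<open>Taking logarithms, the comparison of the two densities becomes a comparison of
  \<open>\<parallel>u + v\<parallel>\<^sup>2 - \<parallel>u\<parallel>\<^sup>2 = 2 (u \<bullet> v) + \<parallel>v\<parallel>\<^sup>2\<close>, summed over \<open>I\<close>, with \<open>2 \<epsilon> \<sigma>\<^sup>2\<close>: the quadratic terms in the
  noise \<open>u\<close> cancel and only a linear functional of it is left.\<close>

lemma gaussian_privacy_loss_iff: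
  fixes u v :: "'i \<Rightarrow> real ^ 'm"
  assumes "finite I" and "0 < \<sigma>"
  shows "exp \<epsilon> * (\<Prod>i\<in>I. \<Prod>j\<in>UNIV. normal_density 0 \<sigma> ((u i + v i) $ j)) <
      (\<Prod>i\<in>I. \<Prod>j\<in>UNIV. normal_density 0 \<sigma> (u i $ j)) \<longleftrightarrow>
    \<epsilon> * \<sigma>\<^sup>2 - (\<Sum>i\<in>I. (norm (v i))\<^sup>2) / 2 < (\<Sum>i\<in>I. u i \<bullet> v i)"
proof -
  define C where "C = ((1 / sqrt (2 * pi * \<sigma>\<^sup>2)) ^ CARD('m)) ^ card I"
  have "0 < C"
    using \<open>0 < \<sigma>\<close> by (simp add: C_def)
  have dens: "(\<Prod>i\<in>I. \<Prod>j\<in>UNIV. normal_density 0 \<sigma> (z i $ j)) =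
      C * exp (- (\<Sum>i\<in>I. (norm (z i))\<^sup>2) / (2 * \<sigma>\<^sup>2))" for z :: "'i \<Rightarrow> real ^ 'm"
  proof -
    have "(\<Prod>i\<in>I. \<Prod>j\<in>UNIV. normal_density 0 \<sigma> (z i $ j)) =
        C * exp (\<Sum>i\<in>I. - (norm (z i))\<^sup>2 / (2 * \<sigma>\<^sup>2))"
      using \<open>finite I\<close>
      by (simp add: prod_normal_density_eq_exp_norm[OF \<open>0 < \<sigma>\<close>] prod.distrib exp_sum C_def)
    then show ?thesis
      by (simp add: sum_negf sum_divide_distrib)
  qed
  have expand: "(\<Sum>i\<in>I. (norm (u i + v i))\<^sup>2) =
      (\<Sum>i\<in>I. (norm (u i))\<^sup>2) + 2 * (\<Sum>i\<in>I. u i \<bullet> v i) + (\<Sum>i\<in>I. (norm (v i))\<^sup>2)"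
    by (simp add: power2_norm_eq_inner algebra_simps inner_commute sum.distrib sum_distrib_left)
  have compare: "exp \<epsilon> * (C * exp (- A / (2 * \<sigma>\<^sup>2))) < C * exp (- B / (2 * \<sigma>\<^sup>2)) \<longleftrightarrow>
      2 * \<epsilon> * \<sigma>\<^sup>2 + B < A" for A B :: real
  proof -
    have "exp \<epsilon> * (C * exp (- A / (2 * \<sigma>\<^sup>2))) = C * exp (\<epsilon> - A / (2 * \<sigma>\<^sup>2))"
      by (simp add: exp_diff exp_minus field_simps)
    then have "exp \<epsilon> * (C * exp (- A / (2 * \<sigma>\<^sup>2))) < C * exp (- B / (2 * \<sigma>\<^sup>2)) \<longleftrightarrow>
        \<epsilon> - A / (2 * \<sigma>\<^sup>2) < - B / (2 * \<sigma>\<^sup>2)"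
      using \<open>0 < C\<close> by simp
    also have "\<dots> \<longleftrightarrow> 2 * \<epsilon> * \<sigma>\<^sup>2 + B < A"
    proof -
      have "\<epsilon> - A / (2 * \<sigma>\<^sup>2) < - B / (2 * \<sigma>\<^sup>2) \<longleftrightarrow> \<epsilon> < (A - B) / (2 * \<sigma>\<^sup>2)"
        unfolding diff_divide_distrib by linarith
      also have "\<dots> \<longleftrightarrow> \<epsilon> * (2 * \<sigma>\<^sup>2) < A - B"
        using \<open>0 < \<sigma>\<close> by (intro pos_less_divide_eq) simp
      finally show ?thesis
        by (simp add: less_diff_eq mult.left_commute mult.assoc)
    qed
    finally show ?thesis .
  qed
  show ?thesis
    unfolding dens compare expand by linarith
qed

text \<open>If the two noiseless outputs \<open>a\<close> and \<open>a'\<close> agree on \<open>I\<close>, so do the noisy ones. This covers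
  \<open>\<sigma> = 0\<close>, as \<open>kappa \<delta> \<epsilon>\<close> is positive. Otherwise \<open>\<sigma>\<close> is positive, the outputs have joint densities,
  and the set on which their ratio exceeds \<open>exp \<epsilon>\<close> is the event that a normal variable with
  deviation \<open>\<sigma> * d\<close> exceeds \<open>\<epsilon> * \<sigma>\<^sup>2 - d\<^sup>2 / 2\<close>, where \<open>d\<close> is the distance of the noiseless outputs. The
  choice of \<open>\<sigma>\<close> makes this probability at most \<open>\<delta>\<close>.\<close>

lemma (in prob_space) gaussian_mechanism_private:
  fixes w :: "'i \<Rightarrow> 'a \<Rightarrow> real ^ 'm"
  assumes "finite I" and indep: "indep_vars (\<lambda>_. borel) w I"
    and w [measurable]: "\<And>i. random_variable borel (w i)"
    and law: "\<And>i. distr M borel (w i) = isotropic_gaussian \<sigma>"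
    and "0 < \<epsilon>" and "0 < \<delta>" and "\<delta> < 1"
    and \<sigma>: "kappa \<delta> \<epsilon> * sqrt (\<Sum>i\<in>I. (norm (a i - a' i))\<^sup>2) \<le> \<sigma>"
    and S: "S \<in> sets (\<Pi>\<^sub>M i\<in>I. borel)"
  shows "prob {\<omega> \<in> space M. (\<lambda>i\<in>I. a i + w i \<omega>) \<in> S} \<le>
    exp \<epsilon> * prob {\<omega> \<in> space M. (\<lambda>i\<in>I. a' i + w i \<omega>) \<in> S} + \<delta>"
proof (cases "\<forall>i\<in>I. a i = a' i")
  case True
  then have "(\<lambda>i\<in>I. a i + w i \<omega>) = (\<lambda>i\<in>I. a' i + w i \<omega>)" for \<omega>
    by auto
  moreover have "p \<le> exp \<epsilon> * p + \<delta>" if "0 \<le> p" for p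
    using mult_right_mono[of 1 "exp \<epsilon>" p] that \<open>0 < \<epsilon>\<close> \<open>0 < \<delta>\<close> by simp
  ultimately show ?thesis
    by simp
next
  case False
  define v where "v i = a i - a' i" for i
  define d where "d = sqrt (\<Sum>i\<in>I. (norm (v i))\<^sup>2)"
  obtain i\<^sub>0 where i\<^sub>0: "i\<^sub>0 \<in> I" "v i\<^sub>0 \<noteq> 0"
    using False by (auto simp: v_def)
  then have "0 < (\<Sum>i\<in>I. (norm (v i))\<^sup>2)"
    using \<open>finite I\<close> by (intro sum_pos2[of I i\<^sub>0]) auto
  then have d: "0 < d" "d\<^sup>2 = (\<Sum>i\<in>I. (norm (v i))\<^sup>2)"
    by (auto simp: d_def)
  have \<sigma>d: "kappa \<delta> \<epsilon> * d \<le> \<sigma>"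
    using \<sigma> by (simp add: d_def v_def)
  have "0 < \<sigma>"
    using \<sigma>d d(1) kappa_pos[OF \<open>0 < \<epsilon>\<close>, of \<delta>] by (smt (verit) mult_pos_pos)

  define \<phi> where "\<phi> u = (\<Prod>j\<in>UNIV. normal_density 0 \<sigma> (u $ j))" for u :: "real ^ 'm"
  have [measurable]: "(\<lambda>u :: real ^ 'm. u $ j) \<in> borel_measurable borel" for j
    by (intro borel_measurable_continuous_onI continuous_intros)
  have \<phi> [measurable]: "\<phi> \<in> borel_measurable borel"
    unfolding \<phi>_def by measurable
  have \<phi>_nonneg: "0 \<le> \<phi> u" for u
    by (simp add: \<phi>_def prod_nonneg)
  have shifted: "distributed M lborel (\<lambda>\<omega>. c + w i \<omega>) (\<lambda>y. ennreal (\<phi> (y - c)))" for c i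
  proof -
    have law_i: "distr M borel (w i) = density lborel (\<lambda>u. ennreal (\<phi> u))"
      using \<open>0 < \<sigma>\<close> by (simp add: law isotropic_gaussian_def \<phi>_def)
    have "distr M lborel (\<lambda>\<omega>. c + w i \<omega>) = distr (distr M borel (w i)) borel ((+) c)"
      by (subst distr_distr) (auto simp: comp_def cong: distr_cong)
    also have "\<dots> = distr (density lborel (\<lambda>u. ennreal (\<phi> u))) borel ((+) c)"
      by (simp add: law_i)
    also have "\<dots> = density (distr lborel borel ((+) c)) (\<lambda>y. ennreal (\<phi> (y - c)))"
      by (subst density_distr) (auto simp: comp_def)
    finally show ?thesis
      by (auto simp: distributed_def lborel_distr_plus)
  qed
  have joint: "distributed M (\<Pi>\<^sub>M i\<in>I. lborel) (\<lambda>\<omega>. \<lambda>i\<in>I. c i + w i \<omega>) (\<lambda>y. \<Prod>i\<in>I. ennreal (\<phi> (y i - c i)))" for c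
    using \<open>finite I\<close> i\<^sub>0(1) shifted
    by (intro joint_distributed_PiM indep_vars_compose2[OF indep] lborel.sigma_finite_measure_axioms) auto
  have PiM_eq: "sets (\<Pi>\<^sub>M i\<in>I. (lborel :: (real ^ 'm) measure)) = sets (\<Pi>\<^sub>M i\<in>I. borel)"
    by (intro sets_PiM_cong) auto

  let ?Y = "\<lambda>\<omega>. \<lambda>i\<in>I. a i + w i \<omega>" and ?Y' = "\<lambda>\<omega>. \<lambda>i\<in>I. a' i + w i \<omega>"
  \<comment> \<open>the outputs at which the privacy loss exceeds \<open>\<epsilon>\<close>, as an event of the noise\<close>
  let ?L = "{\<omega> \<in> space M. ennreal (exp \<epsilon>) * (\<Prod>i\<in>I. ennreal (\<phi> (?Y \<omega> i - a' i))) < (\<Prod>i\<in>I. ennreal (\<phi> (?Y \<omega> i - a i)))}"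
  let ?T = "\<lambda>\<omega>. \<Sum>i\<in>I. w i \<omega> \<bullet> v i"
  have loss: "?L = {\<omega> \<in> space M. \<epsilon> * \<sigma>\<^sup>2 - d\<^sup>2 / 2 < ?T \<omega>}"
  proof -
    have "ennreal (exp \<epsilon>) * (\<Prod>i\<in>I. ennreal (\<phi> (?Y \<omega> i - a' i))) < (\<Prod>i\<in>I. ennreal (\<phi> (?Y \<omega> i - a i))) \<longleftrightarrow>
        exp \<epsilon> * (\<Prod>i\<in>I. \<phi> (w i \<omega> + v i)) < (\<Prod>i\<in>I. \<phi> (w i \<omega>))" for \<omega>
    proof -
      have "(\<Prod>i\<in>I. ennreal (\<phi> (?Y \<omega> i - a' i))) = ennreal (\<Prod>i\<in>I. \<phi> (w i \<omega> + v i))"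
        by (subst prod_ennreal[symmetric]) (auto simp: \<phi>_nonneg v_def algebra_simps intro!: prod.cong)
      moreover have "(\<Prod>i\<in>I. ennreal (\<phi> (?Y \<omega> i - a i))) = ennreal (\<Prod>i\<in>I. \<phi> (w i \<omega>))"
        by (subst prod_ennreal[symmetric]) (auto simp: \<phi>_nonneg intro!: prod.cong)
      ultimately show ?thesis
        by (simp add: ennreal_mult[symmetric] ennreal_less_iff prod_nonneg \<phi>_nonneg)
    qed
    then show ?thesis
      unfolding \<phi>_def d(2) gaussian_privacy_loss_iff[OF \<open>finite I\<close> \<open>0 < \<sigma>\<close>] by simp
  qed
  have "distributed M lborel ?T (normal_density 0 (sqrt (\<Sum>i\<in>I. (\<sigma> * norm (v i))\<^sup>2)))"
  proof (rule sum_indep_centred_normal)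
    show "indep_vars (\<lambda>_. borel) (\<lambda>i \<omega>. w i \<omega> \<bullet> v i) I"
      by (rule indep_vars_compose2[OF indep]) auto
    show "distributed M lborel (\<lambda>\<omega>. w i \<omega> \<bullet> v i) (normal_density 0 (\<sigma> * norm (v i)))"
      if "0 < \<sigma> * norm (v i)" for i
      using that \<open>0 < \<sigma>\<close> by (intro inner_isotropic_gaussian w law) auto
    show "0 < (\<Sum>i\<in>I. (\<sigma> * norm (v i))\<^sup>2)"
      using \<open>0 < \<sigma>\<close> d(1) by (simp add: power_mult_distrib sum_distrib_left[symmetric] d(2)[symmetric])
  qed (use \<open>finite I\<close> \<open>0 < \<sigma>\<close> in auto)
  also have "sqrt (\<Sum>i\<in>I. (\<sigma> * norm (v i))\<^sup>2) = \<sigma> * d"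
    using \<open>0 < \<sigma>\<close> d(1)
    by (simp add: power_mult_distrib sum_distrib_left[symmetric] d(2)[symmetric] real_sqrt_mult)
  finally have "prob ?L \<le> gaussian_tail ((\<epsilon> * \<sigma>\<^sup>2 - d\<^sup>2 / 2) / (\<sigma> * d))"
    unfolding loss using \<open>0 < \<sigma>\<close> d(1) by (intro prob_normal_gt_le_gaussian_tail) auto
  also have "\<dots> \<le> gaussian_tail (inv gaussian_tail \<delta>)"
    using \<open>0 < \<epsilon>\<close> d(1) \<sigma>d by (intro gaussian_tail_antimono inv_gaussian_tail_le_privacy_threshold)
  also have "\<dots> = \<delta>"
    using \<open>0 < \<delta>\<close> \<open>\<delta> < 1\<close> by (rule gaussian_tail_inv)
  finally have tail: "prob ?L \<le> \<delta>" .

  have "emeasure M (?Y -` S \<inter> space M) \<le> ennreal (exp \<epsilon>) * emeasure M (?Y' -` S \<inter> space M) + emeasure M ?L"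
    using S by (intro prob_le_of_privacy_loss[OF joint joint]) (simp add: PiM_eq)
  then have "prob (?Y -` S \<inter> space M) \<le> exp \<epsilon> * prob (?Y' -` S \<inter> space M) + prob ?L"
    by (simp add: emeasure_eq_measure ennreal_mult[symmetric] ennreal_plus[symmetric] del: ennreal_plus)
  moreover have "Y -` S \<inter> space M = {\<omega> \<in> space M. Y \<omega> \<in> S}" for Y :: "'a \<Rightarrow> 'i \<Rightarrow> real ^ 'm"
    by auto
  ultimately show ?thesis
    using tail by simp
qed

theorem theorem3:
  fixes X :: "(real ^ 'n) set"
    and g :: "real ^ 'n \<Rightarrow> real ^ 'm"
    and b :: "'n \<Rightarrow> real"
    and \<epsilon> \<delta> \<sigma> :: real
    and P :: "'w measure"
    and w :: "nat \<Rightarrow> 'w \<Rightarrow> real ^ 'm"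
  assumes "X \<noteq> {}" and "compact X" and "convex X"
    and "\<And>i. convex_on UNIV (\<lambda>x. g x $ i)"
    and "\<And>i. C2 (\<lambda>x. g x $ i)"
    and "\<And>i. 0 \<le> b i"
    and "0 < \<epsilon>" and "0 < \<delta>" and "\<delta> < 1"
    and "prob_space P"
    and "prob_space.indep_vars P (\<lambda>_. borel) w UNIV"
    and "\<And>k. distr P borel (w k) = isotropic_gaussian \<sigma>"
    and "\<sigma> \<ge> kappa \<delta> \<epsilon> * lipschitz_const X g * Max (range b)"
  shows "differentially_private P X b \<epsilon> \<delta> (\<lambda>x \<omega> k. g (x k) + w k \<omega>)"
proof -
  interpret prob_space P
    by fact
  let ?K = "lipschitz_const X g"
  have [measurable]: "random_variable borel (w k)" for k
    using assms(11) by (auto simp: indep_vars_def)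
  have "\<exists>C. C-lipschitz_on X g"
    by (intro lipschitz_on_vec_components C2_lipschitz_on_compact_convex assms)
  then have lip: "?K-lipschitz_on X g"
    using lipschitz_const_lipschitz by blast
  show ?thesis
    unfolding differentially_private_def mechanism_def
  proof (intro conjI allI impI ballI)
    show "(\<lambda>\<omega>. g (x k) + w k \<omega>) \<in> borel_measurable P" for x :: "nat \<Rightarrow> real ^ 'n" and k
      by measurable
  next
    fix x x' :: "nat \<Rightarrow> real ^ 'n" and k :: nat and S
    assume x: "\<forall>k. x k \<in> X" and x': "\<forall>k. x' k \<in> X" and adj: "Adj b x x'"
      and S: "S \<in> sets (\<Pi>\<^sub>M i\<in>{0..k}. (borel :: (real ^ 'm) measure))"
    have "(\<Sum>i\<in>{0..k}. (norm (g (x i) - g (x' i)))\<^sup>2) \<le> (\<Sum>i\<in>{0..k}. (?K * norm (x i - x' i))\<^sup>2)"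
      using x x' by (intro sum_mono power_mono lipschitz_on_normD[OF lip]) auto
    also have "\<dots> = ?K\<^sup>2 * (\<Sum>i\<in>{0..k}. (norm (x i - x' i))\<^sup>2)"
      by (simp add: power_mult_distrib sum_distrib_left)
    finally have "sqrt (\<Sum>i\<in>{0..k}. (norm (g (x i) - g (x' i)))\<^sup>2) \<le>
        ?K * sqrt (\<Sum>i\<in>{0..k}. (norm (x i - x' i))\<^sup>2)"
      using lipschitz_on_nonneg[OF lip] real_sqrt_le_mono by (fastforce simp: real_sqrt_mult)
    also have "\<dots> \<le> ?K * Max (range b)"
      using lipschitz_on_nonneg[OF lip] Adj_sum_norm_le[OF adj] by (intro mult_left_mono) auto
    finally have "kappa \<delta> \<epsilon> * sqrt (\<Sum>i\<in>{0..k}. (norm (g (x i) - g (x' i)))\<^sup>2) \<le>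
        kappa \<delta> \<epsilon> * (?K * Max (range b))"
      using kappa_pos[OF \<open>0 < \<epsilon>\<close>, of \<delta>] by (intro mult_left_mono) auto
    also have "\<dots> \<le> \<sigma>"
      using assms(13) by (simp add: mult.assoc)
    finally show "\<P>(\<omega> in P. restrict (\<lambda>k. g (x k) + w k \<omega>) {0..k} \<in> S)
        \<le> exp \<epsilon> * \<P>(\<omega> in P. restrict (\<lambda>k. g (x' k) + w k \<omega>) {0..k} \<in> S) + \<delta>"
      using assms S indep_vars_subset[OF assms(11)]
      by (intro gaussian_mechanism_private) auto
  qed
qed

end
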